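(* Let $x>0$, let $\sigma,\mu,\xi,\zeta,\vartheta\in\mathbb{C}$, $\eta,\nu,k\in\mathbb{R}$ and $q\in\mathbb{R}^+$, with $\Re(\sigma)>0$, $\Re(\xi)>0$, $\Re(\zeta)>0$, $\Re(\vartheta)>0$, $\eta>0$. Assume that $\frac{\xi}{k}$ and $\frac{\nu}{\eta}$ are positive real numbers and $1+\frac{\xi}{k}-q\ge 0$, and that the left-hand side below is defined and the Fox-Wright series on the right-hand side converges. Then $$\left({}^{\eta}D^{\sigma}_{0+}\,t^\mu E^{\vartheta,q}_{k,\xi,\zeta}(t^\nu)\right)(x)=x^{\mu-\sigma\eta}\,\frac{\eta^\sigma}{\Gamma\left(\frac{\vartheta}{k}\right)}\,k^{1-\frac{\zeta}{k}}\;{}_{2}\Psi_{2}\left[\begin{array}{c}\left(\frac{\vartheta}{k},q\right),\ \left(\frac{\mu}{\eta}+1,\frac{\nu}{\eta}\right);\\ \left(\frac{\zeta}{k},\frac{\xi}{k}\right),\ \left(\frac{\mu}{\eta}-\sigma+1,\frac{\nu}{\eta}\right);\end{array}\ k^{\,q-\frac{\xi}{k}}\,x^{\nu}\right].$$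
   Context: The $k$-gamma function is $\Gamma_k(\vartheta)=k^{\frac{\vartheta}{k}-1}\Gamma\left(\frac{\vartheta}{k}\right)$, and the $k$-Pochhammer symbol is $(\vartheta)_{nq,k}=k^{nq}\left(\frac{\vartheta}{k}\right)_{nq}$, where $(a)_{nq}=\Gamma(a+nq)/\Gamma(a)$. The generalized $k$-Mittag-Leffler function is $$E^{\vartheta,q}_{k,\xi,\zeta}(z)=\sum_{n=0}^\infty\frac{(\vartheta)_{nq,k}\,z^n}{\Gamma_k(n\xi+\zeta)\,n!},$$ for $k\in\mathbb{R}$, $\Re(\xi)>0$, $\Re(\zeta)>0$, $\Re(\vartheta)>0$, $q\in\mathbb{R}^+$. The Fox-Wright function is $${}_p\Psi_q\left[\begin{array}{c}(a_1,\xi_1),\dots,(a_p,\xi_p);\\ (b_1,\zeta_1),\dots,(b_q,\zeta_q);\end{array}\ z\right]=\sum_{n=0}^\infty\frac{\prod_{i=1}^p\Gamma(a_i+\xi_i n)}{\prod_{j=1}^q\Gamma(b_j+\zeta_j n)}\frac{z^n}{n!},$$ where $\xi_i,\zeta_j\in\mathbb{R}^+$ and $1+\sum_j\zeta_j-\sum_i\xi_i\ge0$ (here $p,q$ as subscripts of $\Psi$ are the numbers of parameter pairs). As usual $1/\Gamma$ is $0$ at the poles of $\Gamma$. For $\sigma\in\mathbb{C}$, $\Re(\sigma)>0$, $\eta>0$, $n=[\Re(\sigma)]+1$ (with $[\cdot]$ the integer part) and $x>0$, the generalized fractional derivative is $$\left({}^{\eta}D^{\sigma}_{0+}f(t)\right)(x)=\frac{\eta^{\sigma-n+1}}{\Gamma(n-\sigma)}\left(x^{1-\eta}\frac{d}{dx}\right)^n\int_0^x\frac{t^{\eta-1}f(t)}{(x^\eta-t^\eta)^{\sigma-n+1}}\,dt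 .$$ It is defined when $f$ is defined on $(0,b)$ for some $b>x$ (in particular any series defining $f$ converges there), the integral converges absolutely for all upper limits near $x$, and the indicated derivatives exist at $x$. Here $f(t)=t^\mu E^{\vartheta,q}_{k,\xi,\zeta}(t^\nu)$. *)

theory Defs
  imports "HOL-Analysis.Analysis"
begin

(* All powers with complex exponent are principal values. Gamma is 0 at its poles and division
   by 0 yields 0, so dividing by Gamma follows the convention that 1/Gamma vanishes at the poles;
   rGamma is that reciprocal. *)

definition k_Gamma :: "real \<Rightarrow> complex \<Rightarrow> complex" where
  "k_Gamma k \<theta> = of_real k powr (\<theta> / of_real k - 1) * Gamma (\<theta> / of_real k)"

(* pochhammer with a real index *)
definition real_pochhammer :: "complex \<Rightarrow> real \<Rightarrow> complex" where
  "real_pochhammer a m = Gamma (a + of_real m) / Gamma a"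

definition k_pochhammer :: "real \<Rightarrow> complex \<Rightarrow> real \<Rightarrow> complex" where
  "k_pochhammer k \<theta> m = of_real k powr of_real m * real_pochhammer (\<theta> / of_real k) m"

definition k_mittag_leffler_term ::
    "real \<Rightarrow> complex \<Rightarrow> complex \<Rightarrow> complex \<Rightarrow> real \<Rightarrow> complex \<Rightarrow> nat \<Rightarrow> complex" where
  "k_mittag_leffler_term k \<xi> \<zeta> \<theta> q z n =
     k_pochhammer k \<theta> (of_nat n * q) * z ^ n / (k_Gamma k (of_nat n * \<xi> + \<zeta>) * fact n)"

definition k_mittag_leffler ::
    "real \<Rightarrow> complex \<Rightarrow> complex \<Rightarrow> complex \<Rightarrow> real \<Rightarrow> complex \<Rightarrow> complex" where
  "k_mittag_leffler k \<xi> \<zeta> \<theta> q z = (\<Sum>n. k_mittag_leffler_term k \<xi> \<zeta> \<theta> q z n)"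

definition fox_wright_term ::
    "(complex \<times> real) list \<Rightarrow> (complex \<times> real) list \<Rightarrow> complex \<Rightarrow> nat \<Rightarrow> complex" where
  "fox_wright_term as bs z n =
     (\<Prod>(a, \<alpha>)\<leftarrow>as. Gamma (a + of_real \<alpha> * of_nat n)) *
     (\<Prod>(b, \<beta>)\<leftarrow>bs. rGamma (b + of_real \<beta> * of_nat n)) * (z ^ n / fact n)"

definition fox_wright ::
    "(complex \<times> real) list \<Rightarrow> (complex \<times> real) list \<Rightarrow> complex \<Rightarrow> complex" where
  "fox_wright as bs z = (\<Sum>n. fox_wright_term as bs z n)"

(* the operator x^(1 - eta) d/dx *)
definition weighted_deriv :: "real \<Rightarrow> (real \<Rightarrow> complex) \<Rightarrow> real \<Rightarrow> complex" where
  "weighted_deriv \<eta> g x = of_real (x powr (1 - \<eta>)) * vector_derivative g (at x)"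

(* The n-th iterate of weighted_deriv exists at x: the lower ones exist in a neighbourhood of x,
   and the last differentiation is possible at x itself. *)
primrec weighted_deriv_exists :: "real \<Rightarrow> nat \<Rightarrow> (real \<Rightarrow> complex) \<Rightarrow> real \<Rightarrow> bool" where
  "weighted_deriv_exists \<eta> 0 g x \<longleftrightarrow> True"
| "weighted_deriv_exists \<eta> (Suc n) g x \<longleftrightarrow>
     (\<forall>\<^sub>F y in nhds x. weighted_deriv_exists \<eta> n g y) \<and>
     (weighted_deriv \<eta> ^^ n) g differentiable (at x)"

definition frac_order :: "complex \<Rightarrow> nat" where
  "frac_order \<sigma> = nat \<lfloor>Re \<sigma>\<rfloor> + 1"

definition frac_integrand ::
    "real \<Rightarrow> complex \<Rightarrow> (real \<Rightarrow> complex) \<Rightarrow> real \<Rightarrow> real \<Rightarrow> complex" where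
  "frac_integrand \<eta> \<sigma> f y t =
     of_real (t powr (\<eta> - 1)) * f t /
     of_real (y powr \<eta> - t powr \<eta>) powr (\<sigma> - of_nat (frac_order \<sigma>) + 1)"

definition frac_integral :: "real \<Rightarrow> complex \<Rightarrow> (real \<Rightarrow> complex) \<Rightarrow> real \<Rightarrow> complex" where
  "frac_integral \<eta> \<sigma> f y = (LINT t:{0<..<y}|lborel. frac_integrand \<eta> \<sigma> f y t)"

definition frac_deriv :: "real \<Rightarrow> complex \<Rightarrow> (real \<Rightarrow> complex) \<Rightarrow> real \<Rightarrow> complex" where
  "frac_deriv \<eta> \<sigma> f x =
     of_real \<eta> powr (\<sigma> - of_nat (frac_order \<sigma>) + 1) / Gamma (of_nat (frac_order \<sigma>) - \<sigma>) *
     (weighted_deriv \<eta> ^^ frac_order \<sigma>) (frac_integral \<eta> \<sigma> f) x"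

(* A is the set on which f is really defined (HOL functions being total); for an f given by a
   series it is the set of points where the series converges. *)
definition frac_deriv_defined ::
    "real set \<Rightarrow> real \<Rightarrow> complex \<Rightarrow> (real \<Rightarrow> complex) \<Rightarrow> real \<Rightarrow> bool" where
  "frac_deriv_defined A \<eta> \<sigma> f x \<longleftrightarrow>
     (\<exists>b>x. {0<..<b} \<subseteq> A) \<and>
     (\<forall>\<^sub>F y in nhds x. set_integrable lborel {0<..<y} (frac_integrand \<eta> \<sigma> f y)) \<and>
     weighted_deriv_exists \<eta> (frac_order \<sigma>) (frac_integral \<eta> \<sigma> f) x"

end

theory Submission
  imports Defs
begin

text \<open>The operator acts on a single power by a Beta integral followed by differentiation. Substituting
  \<open>u = t powr \<eta>\<close> in the integral of \<open>t powr p\<close> gives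
  \<open>y powr (p + \<eta> \<delta>) / \<eta> * Beta (p / \<eta> + 1) \<delta>\<close> with \<open>\<delta> = n - \<sigma>\<close>
  (\<open>weighted_Beta_integral\<close>), and each application of \<open>x powr (1 - \<eta>) * d/dx\<close>
  to a power \<open>x powr (\<eta> a)\<close> brings down the factor \<open>\<eta> a\<close> and lowers \<open>a\<close> by one. After
  \<open>n\<close> steps these factors turn the denominator \<open>\<Gamma>(p / \<eta> + 1 + \<delta>)\<close> of the Beta value into
  \<open>\<Gamma>(p / \<eta> + 1 - \<sigma>)\<close>, by the functional equation (\<open>rGamma_minus_nat\<close>). Since this
  equation is used for the entire function \<open>1/\<Gamma>\<close>, poles need no special treatment.

  The function to be differentiated is \<open>t powr \<mu>\<close> times a power series in \<open>t powr \<nu>\<close>, and its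
  domain reaches beyond \<open>x\<close>. The series therefore converges absolutely in a neighbourhood of
  \<open>x\<close> and to the left of it, which justifies all the exchanges of limits: integration and series are exchanged in
  \<open>frac_integral_power_series\<close>, differentiation and series in
  \<open>weighted_deriv_iterate_power_series\<close>. Comparing coefficients with the definition of the
  Fox-Wright function finishes the proof.

  Two points need more care. The Beta integral is required for complex parameters; it is obtained
  from Euler's integral for \<open>\<Gamma>\<close> by computing the integral of a convolution
  (\<open>complex_Beta_integral\<close>). And the Beta integral of the leading term exists only if
  \<open>Re \<mu> + \<eta> > 0\<close>. This follows from the absolute convergence of the integral at
  \<open>x\<close>, because the constant coefficient of the series does not vanish
  (\<open>exponent_bound_of_frac_integrable\<close>).\<close>

section \<open>The Beta integral with complex parameters\<close>

lemma Gamma_nonzero_Re_pos: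
  assumes "Re z > 0"
  shows "Gamma z \<noteq> 0"
proof
  assume "Gamma z = 0"
  then obtain n where "z = of_int n" "n \<le> 0"
    by (auto simp: Gamma_eq_zero_iff elim: nonpos_Ints_cases)
  with assms show False by simp
qed

lemma Gamma_lborel_integral:
  assumes "Re z > 0"
  shows "set_integrable lborel {0<..} (\<lambda>t. of_real t powr (z - 1) / of_real (exp t))"
    and "(LINT t:{0<..}|lborel. of_real t powr (z - 1) / of_real (exp t)) = Gamma z"
proof -
  show *: "set_integrable lborel {0<..} (\<lambda>t. of_real t powr (z - 1) / of_real (exp t))"
    using absolutely_integrable_Gamma_integral'[OF assms] unfolding set_integrable_def
    by (subst (asm) integrable_completion)
       (auto intro!: borel_measurable_continuous_on_indicator continuous_intros)
  show "(LINT t:{0<..}|lborel. of_real t powr (z - 1) / of_real (exp t)) = Gamma z"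
    using set_borel_integral_eq_integral(2)[OF *] Gamma_integral_complex'[OF assms]
    by (simp add: integral_unique)
qed

lemma powr_of_real_mult_complex:
  assumes "u \<ge> 0" "s \<ge> 0"
  shows "complex_of_real (u * s) powr z = of_real u powr z * of_real s powr z"
  using powr_times_real[of "of_real u" "of_real s" z] assms by simp

lemma complex_Beta_integrable:
  fixes a b :: complex
  assumes "Re a > 0" "Re b > 0"
  shows "set_integrable lborel {0<..<1} (\<lambda>s. of_real s powr (a - 1) * of_real (1 - s) powr (b - 1))"
  unfolding set_integrable_def
proof (rule Bochner_Integration.integrable_bound[OF _ _ AE_I2])
  show "integrable lborel (\<lambda>s. indicat_real {0..1} s *\<^sub>R (s powr (Re a - 1) * (1 - s) powr (Re b - 1)))"
    using integrable_Beta[OF assms] by (simp add: set_integrable_def)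
  show "(\<lambda>s. indicator {0<..<1} s *\<^sub>R (complex_of_real s powr (a - 1) * of_real (1 - s) powr (b - 1)))
          \<in> borel_measurable lborel"
    by (auto intro!: borel_measurable_continuous_on_indicator continuous_intros)
qed (auto simp: indicator_def norm_mult norm_powr_real_powr simp flip: of_real_diff)

text \<open>Let \<open>g z\<close> be Euler's integrand for \<open>\<Gamma>(z)\<close>, extended by zero to the real line. The
  convolution of \<open>g a\<close> and \<open>g b\<close> has total integral \<open>\<Gamma>(a) \<Gamma>(b)\<close>. Its value at
  \<open>u > 0\<close> is, after rescaling the integration variable by \<open>u\<close>, the Beta integral times
  \<open>g (a + b) u\<close>, which integrates to \<open>\<Gamma>(a + b)\<close>.\<close>

lemma complex_Beta_integral:
  fixes a b :: complex
  assumes a: "Re a > 0" and b: "Re b > 0"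
  shows "(LINT s:{0<..<1}|lborel. of_real s powr (a - 1) * of_real (1 - s) powr (b - 1)) = Beta a b"
proof -
  define B where "B = (LINT s:{0<..<1}|lborel. of_real s powr (a - 1) * of_real (1 - s) powr (b - 1))"
  define g where "g = (\<lambda>z t. indicator {0<..} t *\<^sub>R (complex_of_real t powr (z - 1) / of_real (exp t)))"
  have g_int: "integrable lborel (g z)" and g_Gamma: "integral\<^sup>L lborel (g z) = Gamma z" if "Re z > 0" for z
    using Gamma_lborel_integral[OF that] unfolding g_def set_integrable_def set_lebesgue_integral_def by auto
  note [measurable] = borel_measurable_integrable[OF g_int[OF a], simplified] 
     borel_measurable_integrable[OF g_int[OF b], simplified]
  have shift: "(LINT u|lborel. h (u - t)) = integral\<^sup>L lborel h" for t and h :: "real \<Rightarrow> 'c::{banach,second_countable_topology}"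
    using lborel_integral_real_affine[of 1 h "-t"] by (simp add: algebra_simps)
  have shift_int: "integrable lborel (\<lambda>u. h (u - t))" if "integrable lborel h" for t and h :: "real \<Rightarrow> complex"
    using lborel_integrable_real_affine[OF that, of 1 "-t"] by (simp add: algebra_simps)
  \<comment> \<open>Translation invariance makes the iterated integral of the norms a product, which licenses Fubini.\<close>
  have "integrable (lborel \<Otimes>\<^sub>M lborel) (\<lambda>(t, u). g a t * g b (u - t))"
  proof (rule lborel_pair.Fubini_integrable)
    have "integrable lborel (\<lambda>t. norm (g a t) * (LINT u|lborel. norm (g b u)))"
      using g_int[OF a] by (intro integrable_mult_left integrable_norm) auto
    also have "(\<lambda>t. norm (g a t) * (LINT u|lborel. norm (g b u))) =
        (\<lambda>t. LINT u|lborel. norm (case (t, u) of (t, u) \<Rightarrow> g a t * g b (u - t)))"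
      using shift[of "\<lambda>u. norm (g b u)"] by (simp add: norm_mult)
    finally show "integrable lborel (\<lambda>t. LINT u|lborel. norm (case (t, u) of (t, u) \<Rightarrow> g a t * g b (u - t)))" .
  qed (auto intro!: AE_I2 shift_int g_int b)
  hence "(LINT t|lborel. LINT u|lborel. g a t * g b (u - t)) = (LINT u|lborel. LINT t|lborel. g a t * g b (u - t))"
    by (rule lborel_pair.Fubini_integral[symmetric])
  also have "(LINT t|lborel. LINT u|lborel. g a t * g b (u - t)) = Gamma a * Gamma b"
    using shift[of "g b"] a b by (simp add: g_Gamma)
  also have "(\<lambda>u. LINT t|lborel. g a t * g b (u - t)) = (\<lambda>u. g (a + b) u * B)"
  proof
    fix u show "(LINT t|lborel. g a t * g b (u - t)) = g (a + b) u * B"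
    proof (cases "u > 0")
      case False
      hence "(\<lambda>t. g a t * g b (u - t)) = (\<lambda>t. 0)"
        by (auto simp: g_def fun_eq_iff indicator_def)
      thus ?thesis using False by (simp add: g_def)
    next
      case True
      have "(LINT t|lborel. g a t * g b (u - t)) = u *\<^sub>R (LINT s|lborel. g a (u * s) * g b (u - u * s))"
        using lborel_integral_real_affine[of u "\<lambda>t. g a t * g b (u - t)" 0] True by simp
      also have "(\<lambda>s. g a (u * s) * g b (u - u * s)) = (\<lambda>s. (of_real u powr (a + b - 2) / of_real (exp u)) *
          (indicator {0<..<1} s *\<^sub>R (of_real s powr (a - 1) * of_real (1 - s) powr (b - 1))))"
      proof
        fix s
        show "g a (u * s) * g b (u - u * s) = (of_real u powr (a + b - 2) / of_real (exp u)) *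
          (indicator {0<..<1} s *\<^sub>R (of_real s powr (a - 1) * of_real (1 - s) powr (b - 1)))"
        proof (cases "s \<in> {0<..<1}")
          case True': True
          have "complex_of_real (u * s) powr (a - 1) = of_real u powr (a - 1) * of_real s powr (a - 1)"
            using True True' by (intro powr_of_real_mult_complex) auto
          moreover have "complex_of_real (u * (1 - s)) powr (b - 1) = of_real u powr (b - 1) * of_real (1 - s) powr (b - 1)"
            using True True' by (intro powr_of_real_mult_complex) auto
          moreover have "complex_of_real u powr (a + b - 2) = of_real u powr (a - 1) * of_real u powr (b - 1)"
            by (simp flip: powr_add)
          moreover have "exp u = exp (u * s) * exp (u * (1 - s))"
            by (simp flip: exp_add add: algebra_simps)
          moreover have "u - u * s = u * (1 - s)" by (simp add: algebra_simps)
          moreover have "u * s > 0" "u * (1 - s) > 0" using True True' by auto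
          ultimately show ?thesis
            unfolding g_def using True' by simp
        next
          case False
          hence "\<not> u * s > 0 \<or> \<not> u - u * s > 0"
            using True by (auto simp: zero_less_mult_iff)
          thus ?thesis using False by (auto simp: g_def)
        qed
      qed
      also have "u *\<^sub>R (LINT s|lborel. (of_real u powr (a + b - 2) / of_real (exp u)) *
          (indicator {0<..<1} s *\<^sub>R (of_real s powr (a - 1) * of_real (1 - s) powr (b - 1)))) =
          (of_real u * of_real u powr (a + b - 2) / of_real (exp u)) * B"
        by (subst integral_mult_right_zero) (simp add: scaleR_conv_of_real set_lebesgue_integral_def B_def)
      also have "of_real u * complex_of_real u powr (a + b - 2) = of_real u powr (a + b - 1)"
        using powr_add[of "complex_of_real u" 1 "a + b - 2"] True by simp
      finally show ?thesis using True by (simp add: g_def)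
    qed
  qed
  also have "(LINT u|lborel. g (a + b) u * B) = Gamma (a + b) * B"
    using a b by (subst integral_mult_left_zero) (simp add: g_Gamma)
  finally have "Gamma a * Gamma b = Gamma (a + b) * B" .
  moreover have "Gamma (a + b) \<noteq> 0"
    using a b by (intro Gamma_nonzero_Re_pos) simp
  ultimately show ?thesis by (simp add: Beta_def field_simps B_def)
qed

section \<open>Complex powers and the functional equation\<close>

lemma cpowr_pos_eq_exp: "t > 0 \<Longrightarrow> complex_of_real t powr z = exp (z * of_real (ln t))"
  by (simp add: powr_def Ln_of_real)

lemma cpowr_add_mult_of_nat:
  assumes "t > 0"
  shows "complex_of_real t powr (p + of_real \<nu> * of_nat n) = of_real t powr p * of_real (t powr \<nu>) ^ n"
proof -
  have "(t powr \<nu>) ^ n = t powr (\<nu> * real n)"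
    using assms by (simp add: powr_powr flip: powr_realpow)
  moreover have "complex_of_real t powr of_real (\<nu> * real n) = of_real (t powr (\<nu> * real n))"
    using assms by (intro powr_of_real) auto
  ultimately show ?thesis by (simp add: powr_add flip: of_real_power)
qed

lemma rGamma_minus_nat:
  "rGamma (z - of_nat N) = rGamma z * (\<Prod>j<N. z - 1 - of_nat j)"
proof (induction N)
  case (Suc N)
  show ?case
    using rGamma_plus1[of "z - 1 - of_nat N"] Suc by (simp add: algebra_simps)
qed simp

section \<open>The fractional integral of a single power\<close>

text \<open>The substitution \<open>s = (t / y) powr \<eta>\<close> maps \<open>{0<..<y}\<close> onto the unit interval and the
  integrand onto a constant multiple of the Beta integrand. The exact constant \<open>C\<close> in the
  proof collects the Jacobian and the powers of \<open>y\<close>.\<close>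

lemma weighted_Beta_integral:
  fixes p \<delta> :: complex and y \<eta> :: real
  assumes y: "y > 0" and \<eta>: "\<eta> > 0" and p: "Re p + \<eta> > 0" and \<delta>: "Re \<delta> > 0"
  defines "w \<equiv> \<lambda>t. of_real (t powr (\<eta> - 1)) * of_real t powr p * of_real (y powr \<eta> - t powr \<eta>) powr (\<delta> - 1)"
  shows "set_integrable lborel {0<..<y} w"
    and "(LINT t:{0<..<y}|lborel. w t) = of_real y powr (p + of_real \<eta> * \<delta>) / of_real \<eta> * Beta (p / of_real \<eta> + 1) \<delta>"
proof -
  define \<phi> where "\<phi> = (\<lambda>t. t powr \<eta> / y powr \<eta>)"
  define h where "h = (\<lambda>t. \<eta> * t powr (\<eta> - 1) / y powr \<eta>)"
  define f where "f = (\<lambda>s. complex_of_real s powr (p / of_real \<eta> + 1 - 1) * of_real (1 - s) powr (\<delta> - 1))"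
  define C where "C = of_real \<eta> / complex_of_real y powr (p + of_real \<eta> * \<delta>)"
  have C: "C \<noteq> 0" using y \<eta> by (simp add: C_def)
  have Re: "Re (p / of_real \<eta> + 1) > 0" using p \<eta> by (simp add: field_simps)
  have img: "\<phi> ` {0<..<y} = {0<..<1}"
  proof (intro equalityI subsetI)
    fix s assume s: "s \<in> {0<..<(1::real)}"
    have "s = \<phi> (y * s powr (1 / \<eta>))" using s y \<eta>
      by (simp add: \<phi>_def powr_mult powr_powr)
    moreover have "s powr (1 / \<eta>) < 1"
      using powr_less_mono2[of "1 / \<eta>" s 1] s \<eta> by simp
    hence "y * s powr (1 / \<eta>) \<in> {0<..<y}" using y s by auto
    ultimately show "s \<in> \<phi> ` {0<..<y}" by blast
  qed (use y \<eta> in \<open>auto simp: \<phi>_def powr_less_mono2\<close>)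
  have inj: "inj_on \<phi> {0<..<y}"
  proof (rule inj_onI)
    fix s t assume st: "s \<in> {0<..<y}" "t \<in> {0<..<y}" and "\<phi> s = \<phi> t"
    hence "(s powr \<eta>) powr (1 / \<eta>) = (t powr \<eta>) powr (1 / \<eta>)"
      using y by (simp add: \<phi>_def)
    thus "s = t" using st \<eta> by (simp add: powr_powr)
  qed
  have deriv: "(\<phi> has_field_derivative h t) (at t within {0<..<y})" if "t \<in> {0<..<y}" for t
    unfolding \<phi>_def h_def using that y
    by (auto intro!: derivative_eq_intros)
  have less: "t powr \<eta> < y powr \<eta>" if "0 < t" "t < y" for t
    using that \<eta> by (intro powr_less_mono2) auto
  have pull: "\<bar>h t\<bar> *\<^sub>R f (\<phi> t) = C * w t" if t: "t \<in> {0<..<y}" for t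
  proof -
    have less: "t powr \<eta> < y powr \<eta>" using less t by simp
    have "of_real (h t) * f (\<phi> t) = C * w t"
    proof -
      have 1: "1 - \<phi> t = (y powr \<eta> - t powr \<eta>) / y powr \<eta>"
        using y by (simp add: \<phi>_def field_simps)
      have 2: "\<phi> t > 0" "1 - \<phi> t > 0" using t y less by (simp_all add: \<phi>_def)
      have l1: "ln (\<phi> t) = \<eta> * ln t - \<eta> * ln y"
        using t y by (simp add: \<phi>_def ln_div ln_powr)
      have l2: "ln (1 - \<phi> t) = ln (y powr \<eta> - t powr \<eta>) - \<eta> * ln y"
        unfolding 1 using y less by (simp add: ln_div ln_powr)
      have f: "f (\<phi> t) = exp (p * of_real (ln t) - p * of_real (ln y)
           + (\<delta> - 1) * of_real (ln (y powr \<eta> - t powr \<eta>)) - of_real \<eta> * (\<delta> - 1) * of_real (ln y))"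
        unfolding f_def cpowr_pos_eq_exp[OF 2(1)] cpowr_pos_eq_exp[OF 2(2)] l1 l2 exp_add[symmetric]
        using \<eta> by (intro arg_cong[where f = exp]) (simp add: field_simps)
      have h: "of_real (h t) = of_real \<eta> * of_real (t powr (\<eta> - 1)) * exp (- (of_real \<eta> * complex_of_real (ln y)))"
        using y by (simp add: h_def powr_def exp_minus divide_inverse flip: exp_of_real)
      have C': "C = of_real \<eta> * exp (- ((p + of_real \<eta> * \<delta>) * of_real (ln y)))"
        using y by (simp add: C_def cpowr_pos_eq_exp divide_inverse flip: exp_minus)
      have w: "w t = of_real (t powr (\<eta> - 1)) * exp (p * of_real (ln t) + (\<delta> - 1) * of_real (ln (y powr \<eta> - t powr \<eta>)))"
        using t less by (simp add: w_def cpowr_pos_eq_exp exp_add del: of_real_diff)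
      show ?thesis unfolding f h C' w
        by (simp add: algebra_simps flip: exp_add)
    qed
    moreover have "h t \<ge> 0" using y \<eta> by (simp add: h_def)
    ultimately show ?thesis by (simp add: scaleR_conv_of_real)
  qed
  have f_int: "set_integrable lborel {0<..<1} f" and f_val: "(LINT s:{0<..<1}|lborel. f s) = Beta (p / of_real \<eta> + 1) \<delta>"
    using complex_Beta_integrable[OF Re \<delta>] complex_Beta_integral[OF Re \<delta>] unfolding f_def by auto
  have f_abs: "f absolutely_integrable_on \<phi> ` {0<..<y}"
    using f_int unfolding img set_integrable_def by (rule integrable_completion[THEN iffD2, rotated]) 
       (use f_int in \<open>auto simp: set_integrable_def dest: borel_measurable_integrable\<close>)
  have "integral (\<phi> ` {0<..<y}) f = Beta (p / of_real \<eta> + 1) \<delta>"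
    using f_val set_borel_integral_eq_integral(2)[OF f_int] img by simp
  with f_abs have "(\<lambda>t. \<bar>h t\<bar> *\<^sub>R f (\<phi> t)) absolutely_integrable_on {0<..<y} \<and>
      integral {0<..<y} (\<lambda>t. \<bar>h t\<bar> *\<^sub>R f (\<phi> t)) = Beta (p / of_real \<eta> + 1) \<delta>"
    by (subst has_absolute_integral_change_of_variables_real[OF _ deriv inj]) auto
  moreover have "(\<lambda>t. \<bar>h t\<bar> *\<^sub>R f (\<phi> t)) absolutely_integrable_on {0<..<y} \<longleftrightarrow>
      (\<lambda>t. C * w t) absolutely_integrable_on {0<..<y}"
    by (rule set_integrable_cong) (auto simp: pull)
  moreover have "integral {0<..<y} (\<lambda>t. \<bar>h t\<bar> *\<^sub>R f (\<phi> t)) = integral {0<..<y} (\<lambda>t. C * w t)"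
    by (rule Henstock_Kurzweil_Integration.integral_cong) (auto simp: pull)
  ultimately have *: "(\<lambda>t. C * w t) absolutely_integrable_on {0<..<y}"
      "C * integral {0<..<y} w = Beta (p / of_real \<eta> + 1) \<delta>"
    by simp_all
  from *(1) have "w absolutely_integrable_on {0<..<y}"
    using set_integrable_mult_right[of "inverse C" lebesgue "{0<..<y}" "\<lambda>t. C * w t"] C
    by (simp flip: mult.assoc)
  moreover have "(\<lambda>t. indicator {0<..<y} t *\<^sub>R w t) \<in> borel_measurable lborel"
  proof -
    have "t powr \<eta> \<le> y powr \<eta>" "y powr \<eta> \<noteq> t powr \<eta>" if "0 < t" "t < y" for t
      using less[of t] that by simp_all
    hence "continuous_on {0<..<y} w"
      unfolding w_def by (intro continuous_intros) (auto simp: complex_nonpos_Reals_iff)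
    thus ?thesis using borel_measurable_continuous_on_indicator[of "{0<..<y}" w] by simp
  qed
  ultimately show int: "set_integrable lborel {0<..<y} w"
    unfolding set_integrable_def by (subst (asm) integrable_completion) auto
  show "(LINT t:{0<..<y}|lborel. w t) = of_real y powr (p + of_real \<eta> * \<delta>) / of_real \<eta> * Beta (p / of_real \<eta> + 1) \<delta>"
    using set_borel_integral_eq_integral(2)[OF int] *(2) C by (simp add: C_def field_simps)
qed

section \<open>Iterated weighted derivatives of power series\<close>

text \<open>An interval of convergence without its right end point suffices for absolute convergence: a point
  strictly between \<open>y\<close> and \<open>b\<close> serves for comparison.\<close>

lemma powser_subst_summable_norm:
  fixes d :: "nat \<Rightarrow> complex"
  assumes "\<nu> > 0" "\<And>t. t \<in> {0<..<b} \<Longrightarrow> summable (\<lambda>n. d n * of_real (t powr \<nu>) ^ n)"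
    and "y \<in> {0<..<b}"
  shows "summable (\<lambda>n. norm (d n) * (y powr \<nu>) ^ n)"
proof -
  define t where "t = (y + b) / 2"
  have t: "t \<in> {0<..<b}" "y < t" using assms(3) by (auto simp: t_def)
  have "y powr \<nu> < t powr \<nu>" using t assms by (auto intro: powr_less_mono2)
  hence "summable (\<lambda>n. norm (d n * of_real (y powr \<nu>) ^ n))"
    by (intro powser_insidea[OF assms(2)[OF t(1)]]) simp
  thus ?thesis by (simp add: norm_mult norm_power)
qed

text \<open>With \<open>w = y powr \<nu>\<close> and \<open>F\<close> the sum of the power series, the product and chain rules give
  \<open>y powr (s - \<eta>) * (s * F w + \<nu> * w * F' w)\<close>, and \<open>w * F' w\<close> multiplies the \<open>n\<close>-th
  coefficient by \<open>n\<close>.\<close>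

lemma weighted_deriv_power_series:
  fixes d :: "nat \<Rightarrow> complex"
  assumes \<nu>: "\<nu> > 0" and sums: "\<And>t. t \<in> {0<..<b} \<Longrightarrow> summable (\<lambda>n. d n * of_real (t powr \<nu>) ^ n)"
    and g: "\<And>t. t \<in> {0<..<b} \<Longrightarrow> g t = of_real t powr s * (\<Sum>n. d n * of_real (t powr \<nu>) ^ n)"
    and y: "y \<in> {0<..<b}"
  shows "summable (\<lambda>n. (s + of_real \<nu> * of_nat n) * d n * of_real (y powr \<nu>) ^ n)"
    and "weighted_deriv \<eta> g y =
           of_real y powr (s - of_real \<eta>) * (\<Sum>n. (s + of_real \<nu> * of_nat n) * d n * of_real (y powr \<nu>) ^ n)"
proof -
  define w where "w = complex_of_real (y powr \<nu>)"
  define F where "F = (\<lambda>z. \<Sum>n. d n * z ^ n)"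
  define F' where "F' = (\<Sum>n. diffs d n * w ^ n)"
  define t where "t = (y + b) / 2"
  have t: "t \<in> {0<..<b}" "y < t" using y by (auto simp: t_def)
  have w_less: "norm w < norm (complex_of_real (t powr \<nu>))"
    using t y \<nu> by (auto simp: w_def intro: powr_less_mono2)
  have F: "(F has_field_derivative F') (at w)"
    unfolding F_def F'_def by (rule termdiffs_strong[OF sums[OF t(1)] w_less])
  have "summable (\<lambda>n. diffs d n * w ^ n)"
    using w_less by (rule termdiff_converges) (auto intro: powser_inside[OF sums[OF t(1)]])
  from sums_mult[OF diffs_equiv[OF this], of w]
  have "(\<lambda>n. w * (of_nat n * d n * w ^ (n - Suc 0))) sums (w * F')"
    by (simp add: F'_def)
  also have "(\<lambda>n. w * (of_nat n * d n * w ^ (n - Suc 0))) = (\<lambda>n. of_nat n * d n * w ^ n)"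
  proof
    fix n show "w * (of_nat n * d n * w ^ (n - Suc 0)) = of_nat n * d n * w ^ n"
      by (cases n) auto
  qed
  finally have "(\<lambda>n. of_nat n * d n * w ^ n) sums (w * F')" .
  moreover have "(\<lambda>n. d n * w ^ n) sums F w"
    unfolding F_def w_def using sums[OF y] by (rule summable_sums)
  ultimately have "(\<lambda>n. s * (d n * w ^ n) + of_real \<nu> * (of_nat n * d n * w ^ n)) sums (s * F w + of_real \<nu> * (w * F'))"
    by (intro sums_add sums_mult)
  hence *: "(\<lambda>n. (s + of_real \<nu> * of_nat n) * d n * w ^ n) sums (s * F w + of_real \<nu> * (w * F'))"
    by (simp add: algebra_simps)
  thus "summable (\<lambda>n. (s + of_real \<nu> * of_nat n) * d n * of_real (y powr \<nu>) ^ n)"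
    by (simp add: w_def sums_iff)
  have pow: "((\<lambda>t. of_real t powr s) has_vector_derivative s * of_real y powr (s - 1)) (at y)"
    using y by (intro has_vector_derivative_real_field has_field_derivative_powr) (auto simp: complex_nonpos_Reals_iff)
  have "((\<lambda>t. complex_of_real (t powr \<nu>)) has_vector_derivative of_real (\<nu> * y powr (\<nu> - 1))) (at y)"
    using y by (intro has_vector_derivative_of_real) 
      (auto intro!: derivative_eq_intros simp flip: has_real_derivative_iff_has_vector_derivative)
  from field_vector_diff_chain_at[OF this F[unfolded w_def]]
  have "((\<lambda>t. F (of_real (t powr \<nu>))) has_vector_derivative of_real (\<nu> * y powr (\<nu> - 1)) * F') (at y)"
    by (simp add: o_def)
  from has_vector_derivative_mult[OF pow this]
  have "((\<lambda>t. of_real t powr s * F (of_real (t powr \<nu>))) has_vector_derivative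
          of_real y powr s * (of_real (\<nu> * y powr (\<nu> - 1)) * F') + s * of_real y powr (s - 1) * F w) (at y)"
    by (simp add: w_def)
  hence "(g has_vector_derivative
          of_real y powr s * (of_real (\<nu> * y powr (\<nu> - 1)) * F') + s * of_real y powr (s - 1) * F w) (at y)"
    by (rule has_vector_derivative_transform_within_open[where S = "{0<..<b}"]) (use y g in \<open>auto simp: F_def\<close>)
  hence "weighted_deriv \<eta> g y = of_real (y powr (1 - \<eta>)) *
       (of_real y powr s * (of_real (\<nu> * y powr (\<nu> - 1)) * F') + s * of_real y powr (s - 1) * F w)"
    by (simp add: weighted_deriv_def vector_derivative_at)
  also have "\<dots> = of_real y powr (s - of_real \<eta>) * (s * F w + of_real \<nu> * (w * F'))"
  proof -
    have 1: "complex_of_real (y powr (1 - \<eta>)) * of_real y powr (s - 1) = of_real y powr (s - of_real \<eta>)"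
      using y by (simp add: powr_of_real[symmetric] flip: powr_add)
    have 2: "complex_of_real (y powr (1 - \<eta>)) * (of_real y powr s * of_real (y powr (\<nu> - 1))) = of_real y powr (s - of_real \<eta>) * w"
      using y by (simp add: powr_of_real[symmetric] w_def algebra_simps flip: powr_add)
    show ?thesis using 1 2
      by (simp add: distrib_left algebra_simps)
  qed
  also have "s * F w + of_real \<nu> * (w * F') = (\<Sum>n. (s + of_real \<nu> * of_nat n) * d n * of_real (y powr \<nu>) ^ n)"
    using * by (simp add: w_def sums_iff)
  finally show "weighted_deriv \<eta> g y =
           of_real y powr (s - of_real \<eta>) * (\<Sum>n. (s + of_real \<nu> * of_nat n) * d n * of_real (y powr \<nu>) ^ n)" .
qed

text \<open>Each derivative again has the form required of \<open>g\<close> on the whole interval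
  \<open>{0<..<b}\<close>, so the previous lemma can be iterated. Having the formula on an open interval, not
  only at one point, is what makes the next derivative computable.\<close>

lemma weighted_deriv_iterate_power_series:
  fixes d :: "nat \<Rightarrow> complex" and s :: complex and \<nu> \<eta> :: real
  assumes \<nu>: "\<nu> > 0" and sums: "\<And>t. t \<in> {0<..<b} \<Longrightarrow> summable (\<lambda>n. d n * of_real (t powr \<nu>) ^ n)"
    and g: "\<And>t. t \<in> {0<..<b} \<Longrightarrow> g t = of_real t powr s * (\<Sum>n. d n * of_real (t powr \<nu>) ^ n)"
    and y: "y \<in> {0<..<b}"
  defines "e \<equiv> \<lambda>m n. (\<Prod>j<m. s - of_nat j * of_real \<eta> + of_real \<nu> * of_nat n) * d n"
  shows "summable (\<lambda>n. e m n * of_real (y powr \<nu>) ^ n) \<and> (weighted_deriv \<eta> ^^ m) g y =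
           of_real y powr (s - of_nat m * of_real \<eta>) * (\<Sum>n. e m n * of_real (y powr \<nu>) ^ n)"
  using y
proof (induction m arbitrary: y)
  case (Suc m)
  have e_Suc: "e (Suc m) n = (s - of_nat m * of_real \<eta> + of_real \<nu> * of_nat n) * e m n" for n
    by (simp add: e_def)
  have "s - of_nat (Suc m) * of_real \<eta> = s - of_nat m * of_real \<eta> - of_real \<eta>"
    by (simp add: algebra_simps)
  with weighted_deriv_power_series(1)[OF \<nu> conjunct1[OF Suc.IH] conjunct2[OF Suc.IH] Suc.prems]
    weighted_deriv_power_series(2)[OF \<nu> conjunct1[OF Suc.IH] conjunct2[OF Suc.IH] Suc.prems, of \<eta>]
  show ?case
    by (simp only: e_Suc funpow.simps o_apply simp_thms)
qed (use sums g in \<open>simp add: e_def\<close>)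

section \<open>The fractional integral of a power series\<close>

lemma frac_integrand_altdef:
  "frac_integrand \<eta> \<sigma> f y t =
    of_real (t powr (\<eta> - 1)) * f t * of_real (y powr \<eta> - t powr \<eta>) powr (of_nat (frac_order \<sigma>) - \<sigma> - 1)"
proof -
  have "of_nat (frac_order \<sigma>) - \<sigma> - 1 = - (\<sigma> - of_nat (frac_order \<sigma>) + 1)" by simp
  thus ?thesis
    unfolding frac_integrand_def by (simp only: powr_minus divide_inverse)
qed

text \<open>Term by term integration is justified by absolute convergence: on \<open>{0<..<y}\<close> the \<open>n\<close>-th
  term is bounded by \<open>norm (c n) * (y powr \<nu>) ^ n\<close> times the integrand of the leading power
  \<open>t powr \<mu>\<close>, and these factors are summable because \<open>y\<close> lies inside the interval of
  convergence.\<close>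

lemma frac_integral_power_series:
  fixes c :: "nat \<Rightarrow> complex" and \<mu> \<sigma> :: complex and y b \<eta> \<nu> :: real
  assumes \<eta>: "\<eta> > 0" and \<nu>: "\<nu> > 0" and \<mu>: "Re \<mu> + \<eta> > 0" and y: "y \<in> {0<..<b}"
    and sums: "\<And>t. t \<in> {0<..<b} \<Longrightarrow> summable (\<lambda>n. c n * of_real (t powr \<nu>) ^ n)"
    and f: "\<And>t. t \<in> {0<..<b} \<Longrightarrow> f t = of_real t powr \<mu> * (\<Sum>n. c n * of_real (t powr \<nu>) ^ n)"
  defines "\<delta> \<equiv> of_nat (frac_order \<sigma>) - \<sigma>"
  assumes \<delta>: "Re \<delta> > 0"
  defines "d \<equiv> \<lambda>n. c n / of_real \<eta> * Beta ((\<mu> + of_real \<nu> * of_nat n) / of_real \<eta> + 1) \<delta>"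
  shows "summable (\<lambda>n. d n * of_real (y powr \<nu>) ^ n)"
    and "frac_integral \<eta> \<sigma> f y = of_real y powr (\<mu> + of_real \<eta> * \<delta>) * (\<Sum>n. d n * of_real (y powr \<nu>) ^ n)"
proof -
  define w where "w = (\<lambda>p t. complex_of_real (t powr (\<eta> - 1)) * of_real t powr p * of_real (y powr \<eta> - t powr \<eta>) powr (\<delta> - 1))"
  define p where "p = (\<lambda>n. \<mu> + of_real \<nu> * of_nat n)"
  define F where "F = (\<lambda>n t. c n * (indicator {0<..<y} t *\<^sub>R w (p n) t))"
  define K where "K = (LINT t|lborel. norm (indicator {0<..<y} t *\<^sub>R w \<mu> t))"
  have y': "y > 0" using y by simp
  have p: "Re (p n) + \<eta> > 0" for n
  proof -
    have "\<nu> * real n \<ge> 0" using \<nu> by simp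
    thus ?thesis using \<mu> by (simp add: p_def del: zero_le_mult_iff)
  qed
  have w_int: "set_integrable lborel {0<..<y} (w z)"
    "(LINT t:{0<..<y}|lborel. w z t) = of_real y powr (z + of_real \<eta> * \<delta>) / of_real \<eta> * Beta (z / of_real \<eta> + 1) \<delta>"
    if "Re z + \<eta> > 0" for z
    unfolding w_def using weighted_Beta_integral[OF y' \<eta> that \<delta>] by auto
  have w_split: "w (p n) t = w \<mu> t * of_real (t powr \<nu>) ^ n" if "t > 0" for n t
  proof -
    have "complex_of_real t powr (p n) = of_real t powr \<mu> * of_real (t powr \<nu>) ^ n"
      unfolding p_def using that by (rule cpowr_add_mult_of_nat)
    thus ?thesis by (simp add: w_def)
  qed
  have F_int: "integrable lborel (F n)" for n
    using w_int(1)[OF p[of n]] unfolding F_def set_integrable_def by (intro integrable_mult_right)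
  have F_bound: "norm (F n t) \<le> norm (c n) * (y powr \<nu>) ^ n * norm (indicator {0<..<y} t *\<^sub>R w \<mu> t)" for n t
  proof (cases "t \<in> {0<..<y}")
    case True
    have "(t powr \<nu>) ^ n \<le> (y powr \<nu>) ^ n"
      using True \<nu> by (intro power_mono powr_mono2) auto
    hence "norm (c n) * norm (w \<mu> t) * (t powr \<nu>) ^ n \<le> norm (c n) * norm (w \<mu> t) * (y powr \<nu>) ^ n"
      by (intro mult_left_mono) auto
    thus ?thesis using True by (simp add: F_def w_split norm_mult norm_power mult_ac)
  qed (simp add: F_def)
  note c_summable = powser_subst_summable_norm[OF \<nu> sums y]
  have "integrable lborel (\<lambda>t. norm (indicator {0<..<y} t *\<^sub>R w \<mu> t))"
    using w_int(1)[OF \<mu>] unfolding set_integrable_def by (rule integrable_norm)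
  hence "(LINT t|lborel. norm (F n t)) \<le> norm (c n) * (y powr \<nu>) ^ n * K" for n
    unfolding K_def by (subst integral_mult_right_zero[symmetric], intro integral_mono F_bound)
       (auto intro!: integrable_norm F_int)
  hence sum1: "summable (\<lambda>n. LINT t|lborel. norm (F n t))"
    by (intro summable_comparison_test'[OF summable_mult2[OF c_summable, of K]]) auto
  have sum2: "summable (\<lambda>n. norm (F n t))" for t
    by (intro summable_comparison_test'[OF summable_mult2[OF c_summable, of "norm (indicator {0<..<y} t *\<^sub>R w \<mu> t)"]])
       (use F_bound in auto)
  have "(\<lambda>n. integral\<^sup>L lborel (F n)) sums (LINT t|lborel. (\<Sum>n. F n t))"
    by (rule sums_integral[OF F_int _ sum1]) (simp add: sum2)
  also have "(\<lambda>t. (\<Sum>n. F n t)) = (\<lambda>t. indicator {0<..<y} t *\<^sub>R frac_integrand \<eta> \<sigma> f y t)"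
  proof
    fix t show "(\<Sum>n. F n t) = indicator {0<..<y} t *\<^sub>R frac_integrand \<eta> \<sigma> f y t"
    proof (cases "t \<in> {0<..<y}")
      case True
      hence t: "t \<in> {0<..<b}" using y by auto
      have "(\<Sum>n. F n t) = (\<Sum>n. w \<mu> t * (c n * of_real (t powr \<nu>) ^ n))"
        using True by (simp add: F_def w_split mult_ac)
      also have "\<dots> = w \<mu> t * (\<Sum>n. c n * of_real (t powr \<nu>) ^ n)"
        by (rule suminf_mult[OF sums[OF t]])
      finally show ?thesis
        using True t frac_integrand_altdef[of \<eta> \<sigma> f y t]
        by (simp add: f w_def \<delta>_def mult_ac)
    qed (simp add: F_def)
  qed
  also have "(LINT t|lborel. indicator {0<..<y} t *\<^sub>R frac_integrand \<eta> \<sigma> f y t) = frac_integral \<eta> \<sigma> f y"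
    by (simp add: frac_integral_def set_lebesgue_integral_def)
  also have "(\<lambda>n. integral\<^sup>L lborel (F n)) = (\<lambda>n. of_real y powr (\<mu> + of_real \<eta> * \<delta>) * (d n * of_real (y powr \<nu>) ^ n))"
  proof
    fix n
    have "integral\<^sup>L lborel (F n) = c n * (LINT t:{0<..<y}|lborel. w (p n) t)"
      unfolding F_def set_lebesgue_integral_def by (rule integral_mult_right_zero)
    also have "\<dots> = c n * (of_real y powr (p n + of_real \<eta> * \<delta>) / of_real \<eta> * Beta (p n / of_real \<eta> + 1) \<delta>)"
      by (subst w_int(2)[OF p]) simp
    also have "of_real y powr (p n + of_real \<eta> * \<delta>) = of_real y powr (\<mu> + of_real \<eta> * \<delta>) * of_real (y powr \<nu>) ^ n"
      using cpowr_add_mult_of_nat[OF y', of "\<mu> + of_real \<eta> * \<delta>" \<nu> n] by (simp add: p_def add_ac)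
    finally show "integral\<^sup>L lborel (F n) = of_real y powr (\<mu> + of_real \<eta> * \<delta>) * (d n * of_real (y powr \<nu>) ^ n)"
      by (simp add: d_def p_def)
  qed
  finally have *: "(\<lambda>n. of_real y powr (\<mu> + of_real \<eta> * \<delta>) * (d n * of_real (y powr \<nu>) ^ n)) sums frac_integral \<eta> \<sigma> f y" .
  thus S: "summable (\<lambda>n. d n * of_real (y powr \<nu>) ^ n)"
    using y' by (auto simp: sums_iff summable_mult_D)
  show "frac_integral \<eta> \<sigma> f y = of_real y powr (\<mu> + of_real \<eta> * \<delta>) * (\<Sum>n. d n * of_real (y powr \<nu>) ^ n)"
    using sums_unique[OF *] suminf_mult[OF S] by simp
qed

section \<open>Integrability forces a bound on the leading exponent\<close>

lemma not_integrable_inverse_near_0: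
  assumes "\<epsilon> > (0::real)"
  shows "\<not> set_integrable lborel {0<..<\<epsilon>} (\<lambda>t. 1 / t)"
proof
  assume int: "set_integrable lborel {0<..<\<epsilon>} (\<lambda>t. 1 / t)"
  define I where "I = (LINT t:{0<..<\<epsilon>}|lborel. 1 / t)"
  have *: "(\<lambda>t. 1 / t) integrable_on {0<..<\<epsilon>}" "I = integral {0<..<\<epsilon>} (\<lambda>t. 1 / t)"
    using set_borel_integral_eq_integral[OF int] by (auto simp: I_def)
  \<comment> \<open>\<open>u\<close> is chosen so that \<open>1 / t\<close> has integral \<open>I + 1\<close> over \<open>{u..v}\<close> alone.\<close>
  define v u where "v = \<epsilon> / 2" and "u = v * exp (- (I + 1))"
  have "I \<ge> 0" unfolding *(2) by (rule integral_nonneg[OF *(1)]) auto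
  hence uv: "0 < u" "u \<le> v" "v < \<epsilon>" using assms by (auto simp: u_def v_def mult_le_cancel_left1)
  have "((\<lambda>t. 1 / t) has_integral (ln v - ln u)) {u..v}"
    using uv by (intro fundamental_theorem_of_calculus)
      (auto intro!: derivative_eq_intros simp flip: has_real_derivative_iff_has_vector_derivative)
  hence "ln v - ln u \<le> I"
    unfolding *(2) using uv by (intro has_integral_subset_le[OF _ _ integrable_integral[OF *(1)]]) auto
  moreover have "ln u = ln v - (I + 1)"
    using uv by (simp add: u_def ln_mult)
  ultimately show False by simp
qed

text \<open>As \<open>t\<close> tends to \<open>0\<close>, the integrand is asymptotically a nonzero constant times
  \<open>t powr (Re \<mu> + \<eta> - 1)\<close> in absolute value. If the exponent were at most \<open>-1\<close>, then
  \<open>1 / t\<close> would be integrable near \<open>0\<close>.\<close>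

lemma exponent_bound_of_frac_integrable:
  fixes c :: "nat \<Rightarrow> complex" and \<mu> \<sigma> :: complex and x b \<eta> \<nu> :: real
  assumes \<eta>: "\<eta> > 0" and \<nu>: "\<nu> > 0" and x: "x \<in> {0<..<b}"
    and sums: "\<And>t. t \<in> {0<..<b} \<Longrightarrow> summable (\<lambda>n. c n * of_real (t powr \<nu>) ^ n)"
    and f: "\<And>t. t \<in> {0<..<b} \<Longrightarrow> f t = of_real t powr \<mu> * (\<Sum>n. c n * of_real (t powr \<nu>) ^ n)"
    and c0: "c 0 \<noteq> 0"
    and int: "set_integrable lborel {0<..<x} (frac_integrand \<eta> \<sigma> f x)"
  shows "Re \<mu> + \<eta> > 0"
proof (rule ccontr)
  assume neg: "\<not> Re \<mu> + \<eta> > 0"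
  define \<delta> where "\<delta> = of_nat (frac_order \<sigma>) - \<sigma>"
  define G where "G = (\<lambda>t. (\<Sum>n. c n * of_real (t powr \<nu>) ^ n) * of_real (x powr \<eta> - t powr \<eta>) powr (\<delta> - 1))"
  have lim: "((\<lambda>t. t powr \<nu>) \<longlongrightarrow> 0) (at_right 0)" "((\<lambda>t. t powr \<eta>) \<longlongrightarrow> 0) (at_right 0)"
    using \<nu> \<eta> by (auto intro!: tendsto_zero_powrI[OF _ tendsto_const] eventually_at_rightI[of 0 1])
  have "isCont (\<lambda>z. \<Sum>n. c n * z ^ n) 0"
    using x by (intro isCont_powser[OF sums[OF x]]) auto
  moreover have "((\<lambda>t. complex_of_real (t powr \<nu>)) \<longlongrightarrow> 0) (at_right 0)"
    using tendsto_of_real[OF lim(1)] by simp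
  ultimately have "((\<lambda>t. \<Sum>n. c n * of_real (t powr \<nu>) ^ n) \<longlongrightarrow> (\<Sum>n. c n * 0 ^ n)) (at_right 0)"
    by (rule isCont_tendsto_compose)
  hence "(G \<longlongrightarrow> c 0 * of_real (x powr \<eta> - 0) powr (\<delta> - 1)) (at_right 0)"
    unfolding G_def powser_zero using x
    by (intro tendsto_intros lim) (auto simp: complex_nonpos_Reals_iff)
  moreover define m where "m = norm (c 0 * of_real (x powr \<eta> - 0) powr (\<delta> - 1))"
  ultimately have "((\<lambda>t. norm (G t)) \<longlongrightarrow> m) (at_right 0)"
    by (simp add: tendsto_norm)
  moreover have "m > 0" using c0 x by (simp add: m_def)
  ultimately have "eventually (\<lambda>t. norm (G t) > m / 2) (at_right 0)"
    by (intro order_tendstoD) auto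
  then obtain e where e: "e > 0" "\<And>t. 0 < t \<Longrightarrow> t < e \<Longrightarrow> norm (G t) > m / 2"
    by (auto simp: eventually_at_right_field)
  \<comment> \<open>Below \<open>1\<close>, powers decrease in the exponent, so \<open>1 / t\<close> bounds \<open>t powr (Re \<mu> + \<eta> - 1)\<close> from below.\<close>
  define \<epsilon> where "\<epsilon> = min e (min x 1)"
  have \<epsilon>: "\<epsilon> > 0" "\<epsilon> \<le> e" "\<epsilon> \<le> x" "\<epsilon> \<le> 1" using e x by (auto simp: \<epsilon>_def)
  have "set_integrable lborel {0<..<\<epsilon>} (frac_integrand \<eta> \<sigma> f x)"
    using \<epsilon> by (intro set_integrable_subset[OF int]) auto
  hence "set_integrable lborel {0<..<\<epsilon>} (\<lambda>t. (2 / m) *\<^sub>R frac_integrand \<eta> \<sigma> f x t)"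
    by (rule set_integrable_scaleR_right)
  hence "set_integrable lborel {0<..<\<epsilon>} (\<lambda>t. 1 / t)"
    unfolding set_integrable_def
  proof (rule Bochner_Integration.integrable_bound[OF _ _ AE_I2])
    show "(\<lambda>t. indicat_real {0<..<\<epsilon>} t *\<^sub>R (1 / t)) \<in> borel_measurable lborel"
      by measurable
    fix t :: real
    show "norm (indicat_real {0<..<\<epsilon>} t *\<^sub>R (1 / t)) \<le>
          norm (indicat_real {0<..<\<epsilon>} t *\<^sub>R (2 / m) *\<^sub>R frac_integrand \<eta> \<sigma> f x t)"
    proof (cases "t \<in> {0<..<\<epsilon>}")
      case True
      hence t: "0 < t" "t < 1" "t \<in> {0<..<x}" "t \<in> {0<..<b}" "t < e" using \<epsilon> x by auto
      have "frac_integrand \<eta> \<sigma> f x t = of_real (t powr (\<eta> - 1)) * of_real t powr \<mu> * G t"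
        unfolding frac_integrand_altdef f[OF t(4)] G_def \<delta>_def by (simp add: mult_ac)
      hence "norm (frac_integrand \<eta> \<sigma> f x t) = t powr (Re \<mu> + \<eta> - 1) * norm (G t)"
        using t by (simp add: norm_mult norm_powr_real_powr algebra_simps flip: powr_add)
      moreover have "t powr (-1) \<le> t powr (Re \<mu> + \<eta> - 1)"
        using t neg by (intro powr_mono') auto
      hence "1 / t \<le> t powr (Re \<mu> + \<eta> - 1)"
        using t by (simp add: powr_minus_divide)
      moreover have "1 \<le> 2 / m * norm (G t)"
        using e(2)[of t] t \<open>m > 0\<close> by (simp add: field_simps)
      ultimately have "1 / t * 1 \<le> t powr (Re \<mu> + \<eta> - 1) * (2 / m * norm (G t))"
        using t by (intro mult_mono) auto
      thus ?thesis using True \<open>m > 0\<close> \<open>norm (frac_integrand \<eta> \<sigma> f x t) = _\<close>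
        by (simp add: mult_ac)
    qed simp
  qed
  thus False using not_integrable_inverse_near_0 \<epsilon> by blast
qed

section \<open>The fractional derivative of a power series\<close>

text \<open>The integer part makes \<open>n - Re \<sigma>\<close> positive, so that the kernel of the fractional integral
  is integrable at the upper limit.\<close>

lemma frac_order_gt:
  assumes "Re \<sigma> > 0"
  shows "Re (of_nat (frac_order \<sigma>) - \<sigma>) > 0"
proof -
  have "real (frac_order \<sigma>) = of_int \<lfloor>Re \<sigma>\<rfloor> + 1"
    using assms by (simp add: frac_order_def)
  thus ?thesis by simp
qed

text \<open>With \<open>\<delta> = N - \<sigma>\<close>, the fractional integral contributes
  \<open>Beta (A n) \<delta> = \<Gamma>(A n) \<Gamma>(\<delta>) / \<Gamma>(A n + \<delta>)\<close> to the \<open>n\<close>-th coefficient, and the \<open>N\<close>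
  derivatives contribute \<open>\<eta> ^ N\<close> times a falling product that replaces
  \<open>1/\<Gamma>(A n + \<delta>)\<close> by \<open>1/\<Gamma>(A n - \<sigma>)\<close>. The remaining factor \<open>\<Gamma>(\<delta>)\<close> is cancelled by the
  normalisation of the fractional derivative.\<close>

lemma frac_deriv_power_series:
  fixes c :: "nat \<Rightarrow> complex" and \<mu> \<sigma> :: complex and x b \<eta> \<nu> :: real
  assumes \<eta>: "\<eta> > 0" and \<nu>: "\<nu> > 0" and \<mu>: "Re \<mu> + \<eta> > 0" and \<sigma>: "Re \<sigma> > 0" and x: "x \<in> {0<..<b}"
    and sums: "\<And>t. t \<in> {0<..<b} \<Longrightarrow> summable (\<lambda>n. c n * of_real (t powr \<nu>) ^ n)"
    and f: "\<And>t. t \<in> {0<..<b} \<Longrightarrow> f t = of_real t powr \<mu> * (\<Sum>n. c n * of_real (t powr \<nu>) ^ n)"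
  defines "A \<equiv> \<lambda>n. \<mu> / of_real \<eta> + 1 + of_real (\<nu> / \<eta>) * of_nat n"
  shows "frac_deriv \<eta> \<sigma> f x = of_real x powr (\<mu> - \<sigma> * of_real \<eta>) * of_real \<eta> powr \<sigma> *
           (\<Sum>n. c n * (Gamma (A n) * rGamma (A n - \<sigma>)) * of_real (x powr \<nu>) ^ n)"
proof -
  define N where "N = frac_order \<sigma>"
  define \<delta> where "\<delta> = of_nat N - \<sigma>"
  have \<delta>: "Re \<delta> > 0" unfolding \<delta>_def N_def using \<sigma> by (rule frac_order_gt)
  define d where "d = (\<lambda>n. c n / of_real \<eta> * Beta ((\<mu> + of_real \<nu> * of_nat n) / of_real \<eta> + 1) \<delta>)"
  define s where "s = \<mu> + of_real \<eta> * \<delta>"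
  define e where "e = (\<lambda>n. (\<Prod>j<N. s - of_nat j * of_real \<eta> + of_real \<nu> * of_nat n) * d n)"
  define K where "K = of_real \<eta> ^ N / of_real \<eta> * Gamma \<delta>"
  define T where "T = (\<lambda>n. c n * (Gamma (A n) * rGamma (A n - \<sigma>)) * of_real (x powr \<nu>) ^ n)"
  have K: "K \<noteq> 0" using \<eta> Gamma_nonzero_Re_pos[OF \<delta>] by (simp add: K_def)
  have \<delta>': "Re (of_nat (frac_order \<sigma>) - \<sigma>) > 0"
    using \<delta> by (simp add: \<delta>_def N_def)
  have int: "summable (\<lambda>n. d n * of_real (y powr \<nu>) ^ n)"
    "frac_integral \<eta> \<sigma> f y = of_real y powr s * (\<Sum>n. d n * of_real (y powr \<nu>) ^ n)"
    if "y \<in> {0<..<b}" for y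
    using frac_integral_power_series[where f = f and c = c and \<mu> = \<mu> and b = b and \<sigma> = \<sigma> and \<nu> = \<nu>,
        OF \<eta> \<nu> \<mu> that sums f \<delta>']
    unfolding d_def s_def \<delta>_def N_def by blast+
  have D: "summable (\<lambda>n. e n * of_real (x powr \<nu>) ^ n)"
    "(weighted_deriv \<eta> ^^ N) (frac_integral \<eta> \<sigma> f) x =
       of_real x powr (s - of_nat N * of_real \<eta>) * (\<Sum>n. e n * of_real (x powr \<nu>) ^ n)"
    using weighted_deriv_iterate_power_series[OF \<nu> int(1) int(2) x, where m = N and \<eta> = \<eta>]
    unfolding e_def by auto
  have e: "e n * of_real (x powr \<nu>) ^ n = K * T n" for n
  proof -
    have A: "(\<mu> + of_real \<nu> * of_nat n) / of_real \<eta> + 1 = A n"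
      using \<eta> by (simp add: A_def field_simps)
    have "s - of_nat j * of_real \<eta> + of_real \<nu> * of_nat n = of_real \<eta> * (A n + \<delta> - 1 - of_nat j)" for j
      using \<eta> by (simp add: A_def s_def field_simps)
    hence prod: "(\<Prod>j<N. s - of_nat j * of_real \<eta> + of_real \<nu> * of_nat n) =
        of_real \<eta> ^ N * (\<Prod>j<N. A n + \<delta> - 1 - of_nat j)"
      by (simp add: prod.distrib)
    have rG: "rGamma (A n - \<sigma>) = rGamma (A n + \<delta>) * (\<Prod>j<N. A n + \<delta> - 1 - of_nat j)"
      using rGamma_minus_nat[of "A n + \<delta>" N] by (simp add: \<delta>_def)
    show ?thesis
      unfolding e_def d_def K_def T_def prod rG A Beta_altdef by (simp add: mult_ac)
  qed
  have "summable T"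
    using D(1) K unfolding e by (simp add: summable_mult_D)
  hence "(\<Sum>n. e n * of_real (x powr \<nu>) ^ n) = K * (\<Sum>n. T n)"
    unfolding e by (rule suminf_mult)
  hence "frac_deriv \<eta> \<sigma> f x = of_real \<eta> powr (\<sigma> - of_nat N + 1) / Gamma \<delta> *
      (of_real x powr (s - of_nat N * of_real \<eta>) * (K * (\<Sum>n. T n)))"
    by (simp add: frac_deriv_def D(2) \<delta>_def flip: N_def)
  also have "s - of_nat N * of_real \<eta> = \<mu> - \<sigma> * of_real \<eta>"
    by (simp add: s_def \<delta>_def algebra_simps)
  also have "of_real \<eta> powr (\<sigma> - of_nat N + 1) = complex_of_real \<eta> powr \<sigma> * of_real \<eta> / of_real \<eta> ^ N"
    using \<eta> by (simp add: powr_add powr_diff powr_nat)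
  finally show "frac_deriv \<eta> \<sigma> f x = of_real x powr (\<mu> - \<sigma> * of_real \<eta>) * of_real \<eta> powr \<sigma> *
           (\<Sum>n. c n * (Gamma (A n) * rGamma (A n - \<sigma>)) * of_real (x powr \<nu>) ^ n)"
    using \<eta> Gamma_nonzero_Re_pos[OF \<delta>] by (simp add: K_def T_def field_simps)
qed

section \<open>The Mittag-Leffler series\<close>

lemma k_mittag_leffler_term_conv_coeff:
  "k_mittag_leffler_term k \<xi> \<zeta> \<theta> q z n = k_mittag_leffler_term k \<xi> \<zeta> \<theta> q 1 n * z ^ n"
  by (simp add: k_mittag_leffler_term_def)

lemma k_mittag_leffler_coeff:
  assumes k: "k > 0" and \<xi>: "\<xi> / of_real k = of_real r"
  shows "k_mittag_leffler_term k \<xi> \<zeta> \<theta> q 1 n =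
     of_real k powr (1 - \<zeta> / of_real k) / Gamma (\<theta> / of_real k) *
     (Gamma (\<theta> / of_real k + of_real q * of_nat n) * rGamma (\<zeta> / of_real k + of_real r * of_nat n) *
     ((of_real k powr (of_real q - \<xi> / of_real k)) ^ n / fact n))"
proof -
  have arg: "(of_nat n * \<xi> + \<zeta>) / of_real k = \<zeta> / of_real k + of_real r * of_nat n"
    by (simp add: add_divide_distrib flip: \<xi>)
  define L where "L = complex_of_real (ln k)"
  have pow: "complex_of_real k powr z = exp (z * L)" for z
    using k by (simp add: cpowr_pos_eq_exp L_def)
  have "exp (of_real (of_nat n * q) * L) / exp ((\<zeta> / of_real k + of_real r * of_nat n - 1) * L) =
     exp ((1 - \<zeta> / of_real k) * L) * exp ((of_real q - of_real r) * L) ^ n"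
    by (simp add: algebra_simps flip: exp_add exp_diff exp_of_nat_mult)
  thus ?thesis
    unfolding k_mittag_leffler_term_def k_pochhammer_def real_pochhammer_def k_Gamma_def arg \<xi> pow
    by (simp add: rGamma_inverse_Gamma field_simps)
qed

theorem theorem1:
  fixes \<sigma> \<mu> \<xi> \<zeta> \<theta> :: complex and x \<eta> \<nu> k q :: real
  assumes "x > 0" and "q > 0" and "\<eta> > 0"
    and "Re \<sigma> > 0" and "Re \<xi> > 0" and "Re \<zeta> > 0" and "Re \<theta> > 0"
    and "\<xi> / of_real k \<in> \<real>" and "Re (\<xi> / of_real k) > 0"
    and "\<nu> / \<eta> > 0"
    and "1 + Re (\<xi> / of_real k) - q \<ge> 0"
    and "frac_deriv_defined {t. summable (k_mittag_leffler_term k \<xi> \<zeta> \<theta> q (of_real (t powr \<nu>)))}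
           \<eta> \<sigma> (\<lambda>t. of_real t powr \<mu> * k_mittag_leffler k \<xi> \<zeta> \<theta> q (of_real (t powr \<nu>))) x"
    and "summable (fox_wright_term
           [(\<theta> / of_real k, q), (\<mu> / of_real \<eta> + 1, \<nu> / \<eta>)]
           [(\<zeta> / of_real k, Re (\<xi> / of_real k)), (\<mu> / of_real \<eta> - \<sigma> + 1, \<nu> / \<eta>)]
           (of_real k powr (of_real q - \<xi> / of_real k) * of_real (x powr \<nu>)))"
  shows "frac_deriv \<eta> \<sigma>
           (\<lambda>t. of_real t powr \<mu> * k_mittag_leffler k \<xi> \<zeta> \<theta> q (of_real (t powr \<nu>))) x =
         of_real x powr (\<mu> - \<sigma> * of_real \<eta>) *
         (of_real \<eta> powr \<sigma> / Gamma (\<theta> / of_real k)) *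
         of_real k powr (1 - \<zeta> / of_real k) *
         fox_wright
           [(\<theta> / of_real k, q), (\<mu> / of_real \<eta> + 1, \<nu> / \<eta>)]
           [(\<zeta> / of_real k, Re (\<xi> / of_real k)), (\<mu> / of_real \<eta> - \<sigma> + 1, \<nu> / \<eta>)]
           (of_real k powr (of_real q - \<xi> / of_real k) * of_real (x powr \<nu>))"
proof -
  define r where "r = Re (\<xi> / of_real k)"
  define f where "f = (\<lambda>t. of_real t powr \<mu> * k_mittag_leffler k \<xi> \<zeta> \<theta> q (of_real (t powr \<nu>)))"
  define c where "c = k_mittag_leffler_term k \<xi> \<zeta> \<theta> q 1"
  define fw where "fw = fox_wright_term
           [(\<theta> / of_real k, q), (\<mu> / of_real \<eta> + 1, \<nu> / \<eta>)]
           [(\<zeta> / of_real k, r), (\<mu> / of_real \<eta> - \<sigma> + 1, \<nu> / \<eta>)]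
           (of_real k powr (of_real q - \<xi> / of_real k) * of_real (x powr \<nu>))"
  define C where "C = of_real k powr (1 - \<zeta> / of_real k) / Gamma (\<theta> / of_real k)"
  have \<xi>: "\<xi> / of_real k = of_real r"
    unfolding r_def using \<open>\<xi> / of_real k \<in> \<real>\<close> by (rule of_real_Re[symmetric])
  have "r > 0" using assms(9) by (simp add: r_def)
  \<comment> \<open>A negative \<open>k\<close> is excluded because both \<open>\<xi> / k\<close> and \<open>Re \<xi>\<close> are positive; \<open>k = 0\<close> would make \<open>\<xi> / k\<close> zero.\<close>
  have k: "k > 0"
  proof -
    have "k \<noteq> 0" using assms(9) by auto
    hence "\<xi> = of_real (r * k)" using \<xi> by (simp add: field_simps)
    hence "r * k > 0" using \<open>Re \<xi> > 0\<close> by simp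
    thus ?thesis using \<open>r > 0\<close> by (simp add: zero_less_mult_iff)
  qed
  have \<nu>: "\<nu> > 0" using \<open>\<nu> / \<eta> > 0\<close> \<open>\<eta> > 0\<close> by (simp add: zero_less_divide_iff)
  have ml_term: "k_mittag_leffler_term k \<xi> \<zeta> \<theta> q z = (\<lambda>n. c n * z ^ n)" for z
    unfolding c_def using k_mittag_leffler_term_conv_coeff by blast
  note coeff = k_mittag_leffler_coeff[OF k \<xi>, of \<zeta> \<theta> q, folded c_def C_def]

  from assms(12) obtain b where "b > x" and
    b: "{0<..<b} \<subseteq> {t. summable (k_mittag_leffler_term k \<xi> \<zeta> \<theta> q (of_real (t powr \<nu>)))}"
    unfolding frac_deriv_defined_def by blast
  hence x: "x \<in> {0<..<b}" using \<open>x > 0\<close> by simp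
  have sums: "summable (\<lambda>n. c n * of_real (t powr \<nu>) ^ n)" if "t \<in> {0<..<b}" for t
    using b that ml_term by auto
  have f: "f t = of_real t powr \<mu> * (\<Sum>n. c n * of_real (t powr \<nu>) ^ n)" for t
    by (simp add: f_def k_mittag_leffler_def ml_term)
  have "set_integrable lborel {0<..<x} (frac_integrand \<eta> \<sigma> f x)"
    using assms(12) unfolding frac_deriv_defined_def f_def by (auto dest: eventually_nhds_x_imp_x)
  moreover have "c 0 \<noteq> 0"
  proof -
    have "Gamma (\<theta> / of_real k) \<noteq> 0" "Gamma (\<zeta> / of_real k) \<noteq> 0"
      using k assms(6,7) by (auto intro!: Gamma_nonzero_Re_pos divide_pos_pos)
    thus ?thesis using k by (simp add: c_def k_mittag_leffler_term_def k_pochhammer_def real_pochhammer_def k_Gamma_def)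
  qed
  ultimately have \<mu>: "Re \<mu> + \<eta> > 0"
    by (intro exponent_bound_of_frac_integrable[OF \<open>\<eta> > 0\<close> \<nu> x sums f])

  have "c n * (Gamma (\<mu> / of_real \<eta> + 1 + of_real (\<nu> / \<eta>) * of_nat n) *
      rGamma (\<mu> / of_real \<eta> + 1 + of_real (\<nu> / \<eta>) * of_nat n - \<sigma>)) * of_real (x powr \<nu>) ^ n = C * fw n" for n
  proof -
    have arg: "\<mu> / of_real \<eta> + 1 + of_real (\<nu> / \<eta>) * of_nat n - \<sigma> =
        \<mu> / of_real \<eta> - \<sigma> + 1 + of_real (\<nu> / \<eta>) * of_nat n" by simp
    show ?thesis
      unfolding coeff fw_def fox_wright_term_def arg
      by (simp add: power_mult_distrib mult_ac del: of_real_divide)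
  qed
  with frac_deriv_power_series[OF \<open>\<eta> > 0\<close> \<nu> \<mu> \<open>Re \<sigma> > 0\<close> x sums f]
  have "frac_deriv \<eta> \<sigma> f x = of_real x powr (\<mu> - \<sigma> * of_real \<eta>) * of_real \<eta> powr \<sigma> * (\<Sum>n. C * fw n)"
    by simp
  also have "(\<Sum>n. C * fw n) = C * (\<Sum>n. fw n)"
    using assms(13) unfolding fw_def r_def by (rule suminf_mult)
  finally show ?thesis
    unfolding f_def C_def fox_wright_def fw_def r_def by simp
qed

end
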